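(* Let $k\ge1$ and let $P_k$ be the path with $k$ edges. Then for all $n\ge k+1$, the uniform matroid ${\mathcal U}_{k-1}(E(K_n))$ of rank $k-1$ on $E(K_n)$ is the unique maximal $P_k$-matroid on $K_n$ (in the weak order), and ${\rm val}_{P_k}$ is its rank function.
   Context: An $H$-matroid on a graph $G$ is a matroid on $E(G)$ in which the edge set of every subgraph of $G$ isomorphic to $H$ is a circuit. Weak order: ${\mathcal M}_1\preceq{\mathcal M}_2$ if every independent set of ${\mathcal M}_1$ is independent in ${\mathcal M}_2$. Let ${\mathcal X}$ be the family of edge sets of subgraphs of $K_n$ isomorphic to $H$. A proper ${\mathcal X}$-sequence is a sequence $(X_1,\dots,X_m)$ of sets in ${\mathcal X}$ with $X_i\not\subseteq\bigcup_{j<i}X_j$ for $i\ge2$; for $F\subseteq E(K_n)$, ${\rm val}(F,{\mathcal S})=|F\cup\bigcup_iX_i|-m$, and ${\rm val}_H(F)=\min_{\mathcal S}{\rm val}(F,{\mathcal S})$ over all proper ${\mathcal X}$-sequences. *)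

theory Defs
  imports Main
begin

record 'v graph =
  verts :: "'v set"
  edges :: "'v set set"

definition simple_graph :: "'v graph \<Rightarrow> bool" where
  "simple_graph G \<longleftrightarrow> finite (verts G) \<and> (\<forall>e \<in> edges G. e \<subseteq> verts G \<and> card e = 2)"

definition complete_graph :: "nat \<Rightarrow> nat graph" where
  "complete_graph n = \<lparr>verts = {1..n}, edges = {e. e \<subseteq> {1..n} \<and> card e = 2}\<rparr>"

definition path_graph :: "nat \<Rightarrow> nat graph" where
  "path_graph k = \<lparr>verts = {0..k}, edges = {{i, Suc i} | i. i < k}\<rparr>"

definition subgraph :: "'v graph \<Rightarrow> 'v graph \<Rightarrow> bool" where
  "subgraph G' G \<longleftrightarrow> simple_graph G' \<and> verts G' \<subseteq> verts G \<and> edges G' \<subseteq> edges G"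

definition graph_iso :: "'u graph \<Rightarrow> 'v graph \<Rightarrow> bool" where
  "graph_iso H G \<longleftrightarrow> (\<exists>f. bij_betw f (verts H) (verts G) \<and>
     (\<forall>u \<in> verts H. \<forall>v \<in> verts H. {u, v} \<in> edges H \<longleftrightarrow> {f u, f v} \<in> edges G))"

definition copies :: "'u graph \<Rightarrow> 'v graph \<Rightarrow> 'v set set set" where
  "copies H G = {edges G' | G'. subgraph G' G \<and> graph_iso H G'}"

text \<open>A matroid is given by its ground set \<open>E\<close> and its family \<open>\<I>\<close> of independent sets.\<close>

locale matroid =
  fixes E :: "'a set" and \<I> :: "'a set set"
  assumes finite_ground: "finite E"
    and indep_subset_ground: "I \<in> \<I> \<Longrightarrow> I \<subseteq> E"
    and indep_empty: "{} \<in> \<I>"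
    and indep_subset: "I \<in> \<I> \<Longrightarrow> J \<subseteq> I \<Longrightarrow> J \<in> \<I>"
    and augment: "I \<in> \<I> \<Longrightarrow> J \<in> \<I> \<Longrightarrow> card I < card J \<Longrightarrow> \<exists>x \<in> J - I. insert x I \<in> \<I>"

definition circuit :: "'a set \<Rightarrow> 'a set set \<Rightarrow> 'a set \<Rightarrow> bool" where
  "circuit E \<I> C \<longleftrightarrow> C \<subseteq> E \<and> C \<notin> \<I> \<and> (\<forall>D. D \<subset> C \<longrightarrow> D \<in> \<I>)"

definition rank_of :: "'a set set \<Rightarrow> 'a set \<Rightarrow> nat" where
  "rank_of \<I> F = Max (card ` {I \<in> \<I>. I \<subseteq> F})"

definition weak_le :: "'a set set \<Rightarrow> 'a set set \<Rightarrow> bool" where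
  "weak_le \<I>\<^sub>1 \<I>\<^sub>2 \<longleftrightarrow> (\<forall>I \<in> \<I>\<^sub>1. I \<in> \<I>\<^sub>2)"

definition uniform_indep :: "nat \<Rightarrow> 'a set \<Rightarrow> 'a set set" where
  "uniform_indep r E = {I. I \<subseteq> E \<and> card I \<le> r}"

definition H_matroid :: "'u graph \<Rightarrow> 'v graph \<Rightarrow> 'v set set set \<Rightarrow> bool" where
  "H_matroid H G \<I> \<longleftrightarrow> matroid (edges G) \<I> \<and> (\<forall>C \<in> copies H G. circuit (edges G) \<I> C)"

definition maximal_H_matroid :: "'u graph \<Rightarrow> 'v graph \<Rightarrow> 'v set set set \<Rightarrow> bool" where
  "maximal_H_matroid H G \<I> \<longleftrightarrow> H_matroid H G \<I> \<and>
     (\<forall>\<J>. H_matroid H G \<J> \<longrightarrow> weak_le \<I> \<J> \<longrightarrow> \<J> = \<I>)"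

text \<open>Lists are indexed from 0, so the condition on \<open>X\<^sub>i\<close> for \<open>i \<ge> 2\<close> concerns the list positions
  \<open>i \<ge> 1\<close>. The empty sequence is proper; it gives the value \<open>card F\<close>.\<close>

definition proper_seq :: "'a set set \<Rightarrow> 'a set list \<Rightarrow> bool" where
  "proper_seq \<X> S \<longleftrightarrow> set S \<subseteq> \<X> \<and>
     (\<forall>i. 1 \<le> i \<and> i < length S \<longrightarrow> \<not> S ! i \<subseteq> (\<Union>j<i. S ! j))"

definition val_seq :: "'a set \<Rightarrow> 'a set list \<Rightarrow> int" where
  "val_seq F S = int (card (F \<union> \<Union> (set S))) - int (length S)"

text \<open>On a finite ground set the length of a proper sequence is bounded (by one more than the size
  of the ground set), so the minimum is over a finite nonempty set of integers.\<close>

definition val :: "'u graph \<Rightarrow> 'v graph \<Rightarrow> 'v set set \<Rightarrow> int" where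
  "val H G F = Min {val_seq F S | S. proper_seq (copies H G) S}"

end

theory Submission
  imports Defs
begin

text \<open>Call a set \<open>C\<close> of edges of \<open>K\<^sub>n\<close> closed if every copy of \<open>P\<^sub>k\<close> with all but one of its edges in
  \<open>C\<close> lies in \<open>C\<close>. A closed set containing one copy of \<open>P\<^sub>k\<close> is all of \<open>E(K\<^sub>n)\<close>: it contains the edge
  closing the path to a cycle, hence (rotating the cycle and reversing an initial segment) all
  chords, hence the edges leaving the vertex set of the path, hence all remaining edges.
  In a \<open>P\<^sub>k\<close>-matroid the span of a copy of \<open>P\<^sub>k\<close> is closed and has rank \<open>k - 1\<close>, so every
  \<open>P\<^sub>k\<close>-matroid lies below the uniform one. The union of a longest proper sequence in which each
  path after the first adds exactly one edge is also closed, which gives the value \<open>k - 1\<close>.\<close>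

section \<open>Paths as vertex lists\<close>

fun path_edges :: "'a list \<Rightarrow> 'a set set" where
  "path_edges (x # y # zs) = insert {x, y} (path_edges (y # zs))"
| "path_edges _ = {}"

lemma path_edges_Cons:
  "path_edges (x # xs) = (if xs = [] then {} else insert {x, hd xs} (path_edges xs))"
  by (cases xs) auto

lemma path_edges_append:
  "path_edges (xs @ ys) = path_edges xs \<union> path_edges ys \<union>
     (if xs = [] \<or> ys = [] then {} else {{last xs, hd ys}})"
  by (induction xs) (auto simp: path_edges_Cons)

lemma path_edges_rev [simp]: "path_edges (rev xs) = path_edges xs"
  by (induction xs) (auto simp: path_edges_Cons path_edges_append last_rev insert_commute)

lemma path_edges_in_set: "e \<in> path_edges xs \<Longrightarrow> e \<subseteq> set xs"
  by (induction xs rule: path_edges.induct) auto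

lemma path_edges_card_2: "distinct xs \<Longrightarrow> e \<in> path_edges xs \<Longrightarrow> card e = 2"
  by (induction xs rule: path_edges.induct) auto

lemma path_edges_pair: "e \<in> path_edges xs \<Longrightarrow> distinct xs \<Longrightarrow>
    \<exists>a b. a \<in> set xs \<and> b \<in> set xs \<and> a \<noteq> b \<and> e = {a, b}"
  by (induction xs rule: path_edges.induct) auto

lemma finite_path_edges [simp]: "finite (path_edges xs)"
  by (induction xs rule: path_edges.induct) auto

lemma card_path_edges: "distinct xs \<Longrightarrow> card (path_edges xs) = length xs - 1"
proof (induction xs rule: path_edges.induct)
  case (1 x y zs)
  then have "{x, y} \<notin> path_edges (y # zs)"
    using path_edges_in_set[of "{x, y}" "y # zs"] by auto
  with 1 show ?case by simp
qed auto

text \<open>Links the recursive form to the edges \<open>{i, Suc i}\<close> of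
  \<open>path_graph\<close>; needed only to identify the copies.\<close>

lemma path_edges_conv_nth: "path_edges xs = {{xs ! i, xs ! Suc i} | i. Suc i < length xs}"
proof (induction xs rule: path_edges.induct)
  case (1 x y zs)
  show ?case (is "_ = ?R")
  proof (intro equalityI subsetI)
    fix e assume "e \<in> path_edges (x # y # zs)"
    then consider "e = {x, y}"
      | i where "e = {(y # zs) ! i, (y # zs) ! Suc i}" "Suc i < length (y # zs)"
      using 1 by auto
    then show "e \<in> ?R"
    proof cases
      case 1
      then show ?thesis by (intro CollectI exI[of _ 0]) auto
    next
      case (2 i)
      then show ?thesis by (intro CollectI exI[of _ "Suc i"]) auto
    qed
  next
    fix e assume "e \<in> ?R"
    then obtain i where i: "e = {(x # y # zs) ! i, (x # y # zs) ! Suc i}"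
      "Suc i < length (x # y # zs)" by auto
    show "e \<in> path_edges (x # y # zs)"
    proof (cases i)
      case 0
      then show ?thesis using i by simp
    next
      case (Suc j)
      then have "e \<in> path_edges (y # zs)" unfolding 1 using i by auto
      then show ?thesis by simp
    qed
  qed
qed auto

text \<open>\<open>Suc k\<close> vertices make \<open>k\<close> edges. A list and its reverse give
  the same copy, which is harmless because only the image under \<open>path_edges\<close>
  matters.\<close>

definition paths :: "nat \<Rightarrow> nat \<Rightarrow> nat list set" where
  "paths k n = {xs. length xs = Suc k \<and> distinct xs \<and> set xs \<subseteq> {1..n}}"

text \<open>An isomorphism \<open>f\<close> becomes the list of its values at \<open>0\<close>, ...,
  \<open>k\<close>; conversely, indexing into a distinct list is an isomorphism. From here on copies
  are handled as vertex lists.\<close>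

lemma copies_path_graph:
  "copies (path_graph k) (complete_graph n) = path_edges ` paths k n"
proof (intro equalityI subsetI)
  fix X assume "X \<in> copies (path_graph k) (complete_graph n)"
  then obtain G f where X: "X = edges G" and G: "subgraph G (complete_graph n)"
    and f: "bij_betw f {0..k} (verts G)"
    and iso: "\<And>u v. u \<in> {0..k} \<Longrightarrow> v \<in> {0..k} \<Longrightarrow>
        {u, v} \<in> edges (path_graph k) \<longleftrightarrow> {f u, f v} \<in> edges G"
    by (auto simp: copies_def graph_iso_def path_graph_def)
  define xs where "xs = map f [0..<Suc k]"
  have nth: "xs ! i = f i" if "i \<le> k" for i
    using that unfolding xs_def by (subst nth_map) (auto simp del: upt_Suc)
  have set_xs: "set xs = f ` {0..k}"
    unfolding xs_def by (auto simp del: upt_Suc)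
  have len: "length xs = Suc k" by (simp add: xs_def)
  have "xs \<in> paths k n"
    using f G len set_xs
    by (auto simp: paths_def xs_def distinct_map bij_betw_def subgraph_def complete_graph_def
        atLeastLessThanSuc_atLeastAtMost simp del: upt_Suc)
  moreover have "X = path_edges xs"
  proof (intro equalityI subsetI)
    fix e assume e: "e \<in> X"
    then have "e \<subseteq> verts G" "card e = 2"
      using G X by (auto simp: subgraph_def simple_graph_def)
    \<comment> \<open>\<open>iso\<close> speaks only of pairs of images under \<open>f\<close>, so
      the edge must first be written as such a pair.\<close>
    then obtain a b where ab: "e = {a, b}" "a \<in> verts G" "b \<in> verts G"
      by (auto simp: card_2_iff)
    then have "a \<in> f ` {0..k}" "b \<in> f ` {0..k}"
      using f by (simp_all add: bij_betw_def)
    then obtain u v where uv: "u \<in> {0..k}" "v \<in> {0..k}" "a = f u" "b = f v"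
      by blast
    then have "{u, v} \<in> edges (path_graph k)" using iso e X ab by auto
    then obtain i where i: "{u, v} = {i, Suc i}" "i < k" by (auto simp: path_graph_def)
    then have "e = {f i, f (Suc i)}" using ab uv by (auto simp: doubleton_eq_iff)
    then have "e = {xs ! i, xs ! Suc i}" using i nth by simp
    then show "e \<in> path_edges xs" using i len by (auto simp: path_edges_conv_nth)
  next
    fix e assume "e \<in> path_edges xs"
    then obtain i where i: "e = {xs ! i, xs ! Suc i}" "i < k"
      using len by (auto simp: path_edges_conv_nth)
    then have "{i, Suc i} \<in> edges (path_graph k)" by (auto simp: path_graph_def)
    then show "e \<in> X" using iso[of i "Suc i"] i nth X by auto
  qed
  ultimately show "X \<in> path_edges ` paths k n" by blast
next
  fix X assume "X \<in> path_edges ` paths k n"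
  then obtain xs where X: "X = path_edges xs" and len: "length xs = Suc k"
    and dist: "distinct xs" and sub: "set xs \<subseteq> {1..n}"
    by (auto simp: paths_def)
  let ?G = "\<lparr>verts = set xs, edges = path_edges xs\<rparr>"
  have "subgraph ?G (complete_graph n)"
    using sub path_edges_in_set[of _ xs] path_edges_card_2[OF dist]
    by (fastforce simp: subgraph_def simple_graph_def complete_graph_def)
  moreover have "graph_iso (path_graph k) ?G"
    unfolding graph_iso_def
  proof (intro exI[of _ "(!) xs"] conjI ballI)
    show "bij_betw ((!) xs) (verts (path_graph k)) (verts ?G)"
      using dist len by (intro bij_betw_nth) (auto simp: path_graph_def)
    fix u v assume uv: "u \<in> verts (path_graph k)" "v \<in> verts (path_graph k)"
    have eq: "{xs ! u, xs ! v} = {xs ! i, xs ! Suc i} \<longleftrightarrow> {u, v} = {i, Suc i}" if "i < k" for i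
      using uv that len dist by (auto simp: doubleton_eq_iff nth_eq_iff_index_eq path_graph_def)
    have "{u, v} \<in> edges (path_graph k) \<longleftrightarrow> (\<exists>i<k. {u, v} = {i, Suc i})"
      by (auto simp: path_graph_def)
    also have "\<dots> \<longleftrightarrow> (\<exists>i<k. {xs ! u, xs ! v} = {xs ! i, xs ! Suc i})"
      using eq by auto
    also have "\<dots> \<longleftrightarrow> {xs ! u, xs ! v} \<in> edges ?G"
      using len by (auto simp: path_edges_conv_nth)
    finally show "{u, v} \<in> edges (path_graph k) \<longleftrightarrow> {xs ! u, xs ! v} \<in> edges ?G" .
  qed
  ultimately show "X \<in> copies (path_graph k) (complete_graph n)"
    using X by (force simp: copies_def)
qed

lemma finite_edges_complete_graph: "finite (edges (complete_graph n))"
  by (simp add: complete_graph_def)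

lemma copies_subset_edges: "X \<in> copies H G \<Longrightarrow> X \<subseteq> edges G"
  by (auto simp: copies_def subgraph_def)

lemma card_copy_path_graph:
  "X \<in> copies (path_graph k) (complete_graph n) \<Longrightarrow> card X = k"
  by (auto simp: copies_path_graph paths_def card_path_edges)

lemma copies_path_graph_nonempty:
  assumes "n \<ge> k + 1"
  shows "copies (path_graph k) (complete_graph n) \<noteq> {}"
proof -
  have "[1..<k + 2] \<in> paths k n" using assms by (auto simp: paths_def)
  then show ?thesis unfolding copies_path_graph by blast
qed

section \<open>Closed edge sets\<close>

text \<open>No matroid appears here, so that the result serves twice: for the span of a path in a
  matroid and for the union of a proper sequence.\<close>

lemma path_closed_set_contains_all_edges:
  assumes k: "k \<ge> 1"
    and X0: "X0 \<in> copies (path_graph k) (complete_graph n)" "X0 \<subseteq> C"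
    and closed: "\<And>X e. X \<in> copies (path_graph k) (complete_graph n) \<Longrightarrow> e \<in> X \<Longrightarrow>
                   X - {e} \<subseteq> C \<Longrightarrow> e \<in> C"
  shows "edges (complete_graph n) \<subseteq> C"
proof -
  obtain xs0 where xs0: "xs0 \<in> paths k n" "path_edges xs0 \<subseteq> C"
    using X0 by (auto simp: copies_path_graph)
  \<comment> \<open>Closedness in the form used below: a path all of whose edges except possibly
    \<open>e\<close> are known to lie in \<open>C\<close>.\<close>
  have step: "e \<in> C" if "xs \<in> paths k n" "path_edges xs = insert e A" "A \<subseteq> C" for xs e A
    by (rule closed[of "path_edges xs"]) (use that in \<open>auto simp: copies_path_graph\<close>)
  \<comment> \<open>Moving the first vertex to the end introduces only the edge that closes the path
    to a cycle.\<close>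
  have rot1: "path_edges (rotate1 xs) \<subseteq> C" if xs: "xs \<in> paths k n" "path_edges xs \<subseteq> C" for xs
  proof -
    obtain x ys where x: "xs = x # ys" "ys \<noteq> []"
      using xs(1) k by (cases xs) (fastforce simp: paths_def)+
    have eq: "path_edges (ys @ [x]) = insert {last ys, x} (path_edges ys)"
      using x by (auto simp: path_edges_append)
    have sub: "path_edges ys \<subseteq> C" using xs x by (auto simp: path_edges_Cons)
    have "ys @ [x] \<in> paths k n" using xs x by (auto simp: paths_def)
    from step[OF this eq sub] show ?thesis using eq sub x by auto
  qed
  have rot: "rotate m xs0 \<in> paths k n \<and> path_edges (rotate m xs0) \<subseteq> C" for m
  proof (induction m)
    case 0
    then show ?case using xs0 by simp
  next
    case (Suc m)
    then show ?case using rot1[of "rotate m xs0"] by (auto simp: paths_def)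
  qed
  let ?V = "set xs0"
  have inner: "{a, b} \<in> C" if ab: "a \<in> ?V" "b \<in> ?V" "a \<noteq> b" for a b
  proof -
    obtain ps qs where "xs0 = ps @ a # qs" using ab by (auto dest: split_list)
    \<comment> \<open>The path is rotated to start at \<open>a\<close>; reversing the segment before
      \<open>b\<close> then makes \<open>a\<close> and \<open>b\<close> adjacent, and
      \<open>{a, b}\<close> is the only edge that can be new.\<close>
    then have r: "rotate (length ps) xs0 = a # (qs @ ps)" by (simp add: rotate_append)
    have "b \<in> set (qs @ ps)" using ab \<open>xs0 = _\<close> by auto
    then obtain us vs where uv: "qs @ ps = us @ b # vs" by (meson split_list)
    have p: "a # us @ b # vs \<in> paths k n" "path_edges (a # us @ b # vs) \<subseteq> C"
      using rot[of "length ps"] r uv by auto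
    have "rev (a # us) @ b # vs \<in> paths k n" using p by (auto simp: paths_def)
    moreover have "path_edges (rev (a # us) @ b # vs) =
        insert {a, b} (path_edges (a # us) \<union> path_edges (b # vs))"
      unfolding path_edges_append path_edges_rev by (auto simp: last_rev)
    moreover have "path_edges (a # us) \<union> path_edges (b # vs) \<subseteq> C"
      using p(2) path_edges_append[of "a # us" "b # vs"] by auto
    ultimately show ?thesis by (rule step)
  qed
  have inner_path: "path_edges xs \<subseteq> C" if "distinct xs" "set xs \<subseteq> ?V" for xs
    using path_edges_pair[of _ xs] inner that by blast
  have cross: "{w, v} \<in> C" if w: "w \<in> {1..n} - ?V" and v: "v \<in> ?V" for v w
  proof -
    obtain ps qs where ps: "xs0 = ps @ v # qs" using v by (auto dest: split_list)
    \<comment> \<open>\<open>butlast\<close> drops one vertex of the old path to make room for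
      \<open>w\<close>, so that \<open>w # ?ys\<close> again has \<open>k + 1\<close>
      vertices.\<close>
    let ?ys = "v # butlast (ps @ qs)"
    have sub: "set (butlast (ps @ qs)) \<subseteq> set (ps @ qs)" by (auto dest: in_set_butlastD)
    have d: "distinct ?ys" "set ?ys \<subseteq> ?V"
      using xs0 ps sub by (auto simp: paths_def distinct_butlast)
    have "w # ?ys \<in> paths k n"
      using d w xs0 ps k by (auto simp: paths_def)
    moreover have "path_edges (w # ?ys) = insert {w, v} (path_edges ?ys)" by simp
    ultimately show ?thesis using inner_path[OF d] by (rule step)
  qed
  have outer: "{w, w'} \<in> C" if w: "w \<in> {1..n} - ?V" "w' \<in> {1..n} - ?V" "w \<noteq> w'" for w w'
  proof -
    \<comment> \<open>Two outer vertices leave room for \<open>k - 1\<close> inner ones. The edge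
      from \<open>w'\<close> to the first of them is covered by \<open>cross\<close>.\<close>
    let ?ys = "take (k - 1) xs0"
    have d: "distinct ?ys" "set ?ys \<subseteq> ?V"
      using xs0 by (auto simp: paths_def dest: in_set_takeD)
    have "w # w' # ?ys \<in> paths k n"
      using d w xs0 k by (auto simp: paths_def)
    moreover have "path_edges (w # w' # ?ys) = insert {w, w'} (path_edges (w' # ?ys))" by simp
    moreover have "path_edges (w' # ?ys) \<subseteq> C"
    \<comment> \<open>The list is empty exactly for \<open>k = 1\<close>, where the path is the
      single edge \<open>{w, w'}\<close>.\<close>
    proof (cases "?ys = []")
      case False
      then have "hd ?ys \<in> ?V" using d(2) hd_in_set by blast
      then show ?thesis using inner_path[OF d] cross[OF w(2)] by (simp add: path_edges_Cons)
    qed (auto simp: path_edges_Cons)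
    ultimately show ?thesis by (rule step)
  qed
  show ?thesis
  proof
    fix e assume "e \<in> edges (complete_graph n)"
    then obtain a b where "e = {a, b}" "a \<noteq> b" "a \<in> {1..n}" "b \<in> {1..n}"
      by (auto simp: complete_graph_def card_2_iff)
    then show "e \<in> C"
      using inner[of a b] cross[of a b] cross[of b a] outer[of a b]
      by (cases "a \<in> ?V"; cases "b \<in> ?V") (auto simp: insert_commute)
  qed
qed

section \<open>Path matroids\<close>

lemma matroid_uniform_indep:
  assumes "finite E"
  shows "matroid E (uniform_indep r E)"
proof
  fix I J assume IJ: "I \<in> uniform_indep r E" "J \<in> uniform_indep r E" "card I < card J"
  then have fin: "finite I" "finite J"
    using assms by (auto simp: uniform_indep_def intro: finite_subset)
  then obtain x where "x \<in> J - I" using IJ(3) by (metis DiffI card_mono leD subsetI)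
  then show "\<exists>x\<in>J - I. insert x I \<in> uniform_indep r E"
    using IJ fin by (intro bexI[of _ x]) (auto simp: uniform_indep_def)
next
  fix I J assume "I \<in> uniform_indep r E" "J \<subseteq> I"
  then show "J \<in> uniform_indep r E"
    using assms card_mono[of I J] by (auto simp: uniform_indep_def dest: finite_subset)
qed (use assms in \<open>auto simp: uniform_indep_def\<close>)

lemma rank_of_uniform_indep:
  assumes "finite E" "F \<subseteq> E"
  shows "rank_of (uniform_indep r E) F = min (card F) r"
proof -
  have fin: "finite F" using assms finite_subset by blast
  obtain I where I: "I \<subseteq> F" "card I = min (card F) r"
    by (metis min.cobounded1 obtain_subset_with_card_n)
  show ?thesis
    unfolding rank_of_def
  proof (rule Max_eqI)
    show "finite (card ` {I \<in> uniform_indep r E. I \<subseteq> F})" using fin by simp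
    show "y \<le> min (card F) r" if "y \<in> card ` {I \<in> uniform_indep r E. I \<subseteq> F}" for y
      using that fin by (auto simp: uniform_indep_def card_mono)
    show "min (card F) r \<in> card ` {I \<in> uniform_indep r E. I \<subseteq> F}"
      using I assms by (intro image_eqI[of _ _ I]) (auto simp: uniform_indep_def)
  qed
qed

text \<open>Every copy has exactly \<open>k\<close> edges, one more than the rank.\<close>

lemma H_matroid_uniform_indep:
  assumes "k \<ge> 1"
  shows "H_matroid (path_graph k) (complete_graph n)
           (uniform_indep (k - 1) (edges (complete_graph n)))"
  unfolding H_matroid_def
proof (intro conjI ballI)
  fix X assume X: "X \<in> copies (path_graph k) (complete_graph n)"
  have sub: "X \<subseteq> edges (complete_graph n)" using X by (rule copies_subset_edges)
  then have "finite X" using finite_edges_complete_graph finite_subset by blast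
  then have "card D \<le> k - 1" if "D \<subset> X" for D
    using psubset_card_mono[OF _ that] card_copy_path_graph[OF X] by simp
  then show "circuit (edges (complete_graph n))
               (uniform_indep (k - 1) (edges (complete_graph n))) X"
    using sub card_copy_path_graph[OF X] assms by (auto simp: circuit_def uniform_indep_def)
qed (simp add: matroid_uniform_indep finite_edges_complete_graph)

text \<open>The span of a copy contains every edge, so no independent set exceeds the
  \<open>k - 1\<close> elements of a basis of that copy. The argument uses augmentation directly
  instead of a rank function.\<close>

lemma path_matroid_weak_le_uniform:
  assumes k: "k \<ge> 1" and n: "n \<ge> k + 1"
    and H: "H_matroid (path_graph k) (complete_graph n) \<I>"
  shows "weak_le \<I> (uniform_indep (k - 1) (edges (complete_graph n)))"
proof -
  let ?E = "edges (complete_graph n)" and ?\<X> = "copies (path_graph k) (complete_graph n)"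
  interpret matroid ?E \<I> using H by (simp add: H_matroid_def)
  have circ: "X \<subseteq> ?E" "X \<notin> \<I>" "\<And>e. e \<in> X \<Longrightarrow> X - {e} \<in> \<I>" "finite X" "card X = k"
    if "X \<in> ?\<X>" for X
  proof -
    have c: "circuit ?E \<I> X" using H that by (auto simp: H_matroid_def)
    then show "X \<subseteq> ?E" "X \<notin> \<I>" by (auto simp: circuit_def)
    then show "finite X" using finite_ground finite_subset by blast
    show "X - {e} \<in> \<I>" if "e \<in> X" for e
      using c that unfolding circuit_def by blast
    show "card X = k" using that by (rule card_copy_path_graph)
  qed
  obtain X0 where X0: "X0 \<in> ?\<X>" using copies_path_graph_nonempty[OF n] by blast
  then obtain e0 where e0: "e0 \<in> X0" using circ(5)[OF X0] k by fastforce
  define B where "B = X0 - {e0}"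
  have B: "B \<in> \<I>" "card B = k - 1" "B \<subseteq> ?E" "finite B"
    using circ[OF X0] e0 by (auto simp: B_def)
  \<comment> \<open>The span of \<open>B\<close>: the elements that do not extend \<open>B\<close>
    to a larger independent set.\<close>
  define C where "C = {e \<in> ?E. e \<in> B \<or> insert e B \<notin> \<I>}"
  \<comment> \<open>A larger independent \<open>J\<close> inside \<open>C\<close> would augment
    \<open>B\<close> by an element of its own span.\<close>
  have small: "card J \<le> k - 1" if "J \<in> \<I>" "J \<subseteq> C" for J
  proof (rule ccontr)
    assume "\<not> ?thesis"
    then obtain x where "x \<in> J - B" "insert x B \<in> \<I>"
      using augment[OF B(1) \<open>J \<in> \<I>\<close>] B(2) by auto
    then show False using that by (auto simp: C_def)
  qed
  have "?E \<subseteq> C"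
  proof (rule path_closed_set_contains_all_edges[OF k X0])
    have "insert e0 B = X0" using e0 by (auto simp: B_def)
    then show "X0 \<subseteq> C" using circ(1,2)[OF X0] by (auto simp: C_def B_def insert_absorb)
    fix X e assume X: "X \<in> ?\<X>" "e \<in> X" "X - {e} \<subseteq> C"
    show "e \<in> C"
    proof (rule ccontr)
      assume "e \<notin> C"
      then have e: "e \<notin> B" "insert e B \<in> \<I>" using circ(1)[OF X(1)] X(2) by (auto simp: C_def)
      have cX: "card (X - {e}) = k - 1" using circ(4,5)[OF X(1)] X(2) by simp
      \<comment> \<open>If \<open>e\<close> is outside the span, \<open>insert e B\<close> has
        \<open>k\<close> elements and augments \<open>X - {e}\<close>. The new element is not
        \<open>e\<close>, since the circuit \<open>X\<close> is dependent; so it comes from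
        \<open>B\<close> and yields \<open>k\<close> independent elements inside \<open>C\<close>,
        against \<open>small\<close>.\<close>
      have "card (X - {e}) < card (insert e B)" using cX e B by simp
      then obtain x where x: "x \<in> insert e B - (X - {e})" "insert x (X - {e}) \<in> \<I>"
        using augment[OF circ(3)[OF X(1,2)] e(2)] by blast
      have "x \<noteq> e" using x circ(2)[OF X(1)] X(2) by (auto simp: insert_absorb)
      then have "x \<in> B" "x \<notin> X - {e}" using x by auto
      then have "card (insert x (X - {e})) = k"
        using circ(4)[OF X(1)] cX k by simp
      moreover have "insert x (X - {e}) \<subseteq> C" using X(3) \<open>x \<in> B\<close> B(3) by (auto simp: C_def)
      ultimately show False using small[OF x(2)] k by simp
    qed
  qed
  then show ?thesis
    using small indep_subset_ground by (fastforce simp: weak_le_def uniform_indep_def)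
qed

text \<open>The uniform matroid lies above all others, so antisymmetry of the weak order gives both
  directions.\<close>

lemma unique_maximal_path_matroid:
  assumes "k \<ge> 1" "n \<ge> k + 1"
  shows "maximal_H_matroid (path_graph k) (complete_graph n) \<I> \<longleftrightarrow>
           \<I> = uniform_indep (k - 1) (edges (complete_graph n))"
proof -
  have "\<J> = \<K>" if "weak_le \<J> \<K>" "weak_le \<K> \<J>" for \<J> \<K> :: "nat set set set"
    using that by (auto simp: weak_le_def)
  then show ?thesis
    using path_matroid_weak_le_uniform[OF assms] H_matroid_uniform_indep[OF assms(1), of n]
    unfolding maximal_H_matroid_def by metis
qed

section \<open>Proper sequences\<close>

text \<open>Turns the condition on positions into a recursive one, for induction from the right and
  for extending a sequence. The case \<open>S = []\<close> reflects that the first set is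
  unconstrained.\<close>

lemma proper_seq_snoc:
  "proper_seq \<X> (S @ [X]) \<longleftrightarrow> proper_seq \<X> S \<and> X \<in> \<X> \<and> (S = [] \<or> \<not> X \<subseteq> \<Union> (set S))"
proof -
  have pre: "(\<Union>j<i. (S @ [X]) ! j) = (\<Union>j<i. S ! j)" if "i \<le> length S" for i
    using that by (intro SUP_cong) (auto simp: nth_append)
  have U: "(\<Union>j<length S. (S @ [X]) ! j) = \<Union> (set S)"
    unfolding pre[OF order_refl] by (auto simp: set_conv_nth)
  have "(\<forall>i. 1 \<le> i \<and> i < length (S @ [X]) \<longrightarrow> \<not> (S @ [X]) ! i \<subseteq> (\<Union>j<i. (S @ [X]) ! j)) \<longleftrightarrow>
        (\<forall>i. 1 \<le> i \<and> i < length S \<longrightarrow> \<not> S ! i \<subseteq> (\<Union>j<i. S ! j)) \<and>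
        (1 \<le> length S \<longrightarrow> \<not> X \<subseteq> \<Union> (set S))"
    (is "(\<forall>i. ?P i) \<longleftrightarrow> (\<forall>i. ?Q i) \<and> ?R")
  proof -
    have "?P i \<longleftrightarrow> ?Q i" if "i < length S" for i
      using that pre[of i] by (simp add: nth_append)
    moreover have "?P (length S) \<longleftrightarrow> ?R" by (simp only: U nth_append_length) simp
    moreover have "?P i" if "i > length S" for i using that by simp
    moreover have "?Q i" if "i \<ge> length S" for i using that by simp
    ultimately show ?thesis by (metis linorder_neqE_nat order_less_imp_le order_refl)
  qed
  then show ?thesis unfolding proper_seq_def by (auto simp: Suc_le_eq)
qed

text \<open>The first set contributes \<open>k\<close> elements and each later one at least one
  more. For \<open>k\<close> at least 1 this bounds the value of a nonempty sequence below by
  \<open>k - 1\<close>.\<close>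

lemma proper_seq_card_Union_ge:
  assumes fin: "\<And>X. X \<in> \<X> \<Longrightarrow> finite X" and card: "\<And>X. X \<in> \<X> \<Longrightarrow> card X = k"
  shows "proper_seq \<X> S \<Longrightarrow> S \<noteq> [] \<Longrightarrow> k + length S \<le> card (\<Union> (set S)) + 1"
proof (induction S rule: rev_induct)
  case (snoc X S)
  show ?case
  proof (cases "S = []")
    case True
    then show ?thesis using snoc.prems card[of X] by (simp add: proper_seq_def)
  next
    case False
    have S: "proper_seq \<X> S" "\<not> X \<subseteq> \<Union> (set S)" "X \<in> \<X>"
      using snoc False by (auto simp: proper_seq_snoc)
    have "set (S @ [X]) \<subseteq> \<X>" using snoc.prems by (simp add: proper_seq_def)
    then have "finite (\<Union> (set (S @ [X])))" using fin by blast
    moreover have "\<Union> (set S) \<subset> \<Union> (set (S @ [X]))" using S(2) by auto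
    ultimately have "card (\<Union> (set S)) < card (\<Union> (set (S @ [X])))"
      by (rule psubset_card_mono)
    then show ?thesis using snoc.IH[OF S(1) False] by simp
  qed
qed simp

text \<open>Among the sequences attaining equality in the preceding bound, a longest one has a
  closed union.\<close>

lemma ex_tight_spanning_proper_seq:
  assumes k: "k \<ge> 1" and n: "n \<ge> k + 1"
  shows "\<exists>S. proper_seq (copies (path_graph k) (complete_graph n)) S \<and>
             \<Union> (set S) = edges (complete_graph n) \<and>
             card (edges (complete_graph n)) + 1 = k + length S"
proof -
  let ?E = "edges (complete_graph n)" and ?\<X> = "copies (path_graph k) (complete_graph n)"
  let ?P = "\<lambda>S. proper_seq ?\<X> S \<and> S \<noteq> [] \<and> card (\<Union> (set S)) + 1 = k + length S"
  have sub: "\<Union> (set S) \<subseteq> ?E" if "proper_seq ?\<X> S" for S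
    using that copies_subset_edges unfolding proper_seq_def by blast
  obtain X0 where X0: "X0 \<in> ?\<X>" using copies_path_graph_nonempty[OF n] by blast
  have "?P [X0]"
    using X0 card_copy_path_graph[OF X0] by (simp add: proper_seq_def)
  \<comment> \<open>A bound on the length is what makes a longest tight sequence exist.\<close>
  moreover have "length S < card ?E + 2" if "?P S" for S
    using card_mono[OF finite_edges_complete_graph sub[of S]] that k by simp
  ultimately obtain S where S: "?P S" and max: "\<And>T. ?P T \<Longrightarrow> length T \<le> length S"
    using ex_has_greatest_nat[of ?P "[X0]" length "card ?E + 2"] by meson
  have fin: "finite (\<Union> (set S))"
    using sub S finite_edges_complete_graph finite_subset by blast
  have "?E \<subseteq> \<Union> (set S)"
  proof (rule path_closed_set_contains_all_edges[OF k])
    show "hd S \<in> ?\<X>" using S by (auto simp: proper_seq_def)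
    show "hd S \<subseteq> \<Union> (set S)" using S by (meson Union_upper hd_in_set)
    fix X e assume X: "X \<in> ?\<X>" "e \<in> X" "X - {e} \<subseteq> \<Union> (set S)"
    show "e \<in> \<Union> (set S)"
    proof (rule ccontr)
      assume e: "e \<notin> \<Union> (set S)"
      \<comment> \<open>\<open>e\<close> is the only edge of \<open>X\<close> outside the union, so
        appending \<open>X\<close> raises both the union size and the length by one and keeps the
        sequence tight.\<close>
      have "\<Union> (set (S @ [X])) = insert e (\<Union> (set S))" using X by auto
      then have "card (\<Union> (set (S @ [X]))) = card (\<Union> (set S)) + 1"
        using card_insert_disjoint[OF fin e] by simp
      moreover have "proper_seq ?\<X> (S @ [X])" using S X e by (auto simp: proper_seq_snoc)
      ultimately have "?P (S @ [X])" using S by simp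
      from max[OF this] show False by simp
    qed
  qed
  then have "\<Union> (set S) = ?E" using sub S by blast
  then show ?thesis using S by auto
qed

text \<open>Two sequences compete: the empty one gives \<open>card F\<close>, and a tight spanning
  one gives \<open>k - 1\<close> whatever \<open>F\<close> is.\<close>

lemma val_path_graph:
  assumes k: "k \<ge> 1" and n: "n \<ge> k + 1" and F: "F \<subseteq> edges (complete_graph n)"
  shows "val (path_graph k) (complete_graph n) F = int (min (card F) (k - 1))"
proof -
  let ?E = "edges (complete_graph n)" and ?\<X> = "copies (path_graph k) (complete_graph n)"
  let ?A = "{val_seq F S | S. proper_seq ?\<X> S}"
  have finE: "finite ?E" by (rule finite_edges_complete_graph)
  have finX: "finite X" if "X \<in> ?\<X>" for X
    using finite_subset[OF copies_subset_edges[OF that] finE] .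
  have sub: "F \<union> \<Union> (set S) \<subseteq> ?E" if "proper_seq ?\<X> S" for S
    using F Union_least[of "set S" ?E] copies_subset_edges[of _ "path_graph k" "complete_graph n"]
      that by (auto simp: proper_seq_def)
  have lower: "int (min (card F) (k - 1)) \<le> val_seq F S" if S: "proper_seq ?\<X> S" for S
  proof (cases "S = []")
    case True
    then show ?thesis by (simp add: val_seq_def)
  next
    case False
    have "k + length S \<le> card (\<Union> (set S)) + 1"
      by (rule proper_seq_card_Union_ge[OF finX card_copy_path_graph S False])
    moreover have "card (\<Union> (set S)) \<le> card (F \<union> \<Union> (set S))"
      using finite_subset[OF sub[OF S] finE] by (intro card_mono) auto
    ultimately show ?thesis using k by (simp add: val_seq_def)
  qed
  \<comment> \<open>Together with \<open>lower\<close> this confines the values to an integer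
    interval; \<open>Min\<close> requires a finite set.\<close>
  have upper: "val_seq F S \<le> int (card ?E)" if "proper_seq ?\<X> S" for S
    using card_mono[OF finE sub[OF that]] by (simp add: val_seq_def)
  have "?A \<subseteq> {int (min (card F) (k - 1))..int (card ?E)}" using lower upper by auto
  then have "finite ?A" by (rule finite_subset) simp
  moreover have "int (min (card F) (k - 1)) \<in> ?A"
  proof (cases "card F \<le> k - 1")
    case True
    then show ?thesis
      by (intro CollectI exI[of _ "[]"]) (auto simp: val_seq_def proper_seq_def)
  next
    case False
    obtain S where S: "proper_seq ?\<X> S" "\<Union> (set S) = ?E" "card ?E + 1 = k + length S"
      using ex_tight_spanning_proper_seq[OF k n] by blast
    \<comment> \<open>\<open>F\<close> is absorbed by the spanning union, so the value is
      \<open>card ?E - length S\<close>.\<close>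
    have "F \<union> \<Union> (set S) = ?E" using F S by auto
    then have "val_seq F S = int (k - 1)" using S(3) k by (simp add: val_seq_def)
    then show ?thesis using S(1) False by (intro CollectI exI[of _ S]) auto
  qed
  ultimately show ?thesis unfolding val_def using lower by (intro Min_eqI) auto
qed

theorem theorem3p5:
  fixes k n :: nat
  assumes "k \<ge> 1" and "n \<ge> k + 1"
  shows "(\<forall>\<I>. maximal_H_matroid (path_graph k) (complete_graph n) \<I> \<longleftrightarrow>
              \<I> = uniform_indep (k - 1) (edges (complete_graph n)))
       \<and> (\<forall>F. F \<subseteq> edges (complete_graph n) \<longrightarrow>
              val (path_graph k) (complete_graph n) F =
              int (rank_of (uniform_indep (k - 1) (edges (complete_graph n))) F))"
  using unique_maximal_path_matroid[OF assms] val_path_graph[OF assms]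
    rank_of_uniform_indep[OF finite_edges_complete_graph]
  by simp

end
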